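(* Let $0<\alpha<1$, $a\ge0$, $n$ a nonnegative integer, and $P_n(t)=\sum_{k=0}^n a_k(t-a)^k$ with $a_k\in\mathbb R$, $k=0,1,\dots,n$. Then, for $t>a$, $${}^c\mathcal D_{\Phi,a+}^\alpha P_n(t)=\sum_{k=1}^n k\,a_k\int_a^t\Psi_{1-\alpha}(t-s;\Theta)(s-a)^{k-1}\,ds.$$ Equivalently, $${}^c\mathcal D_{\Phi,a+}^\alpha P_n(t)=\sum_{k=1}^n k\,a_k\big(\Psi_{1-\alpha}*(\cdot-a)^{k-1}\big)(t),$$ where the convolution is taken over $[a,t]$.
   Context: A dynamic memory generator is a positive function $\Phi(p,\Theta)$ of the Laplace variable $p\in(0,\infty)$ and of fixed modulation parameters $\Theta$. For $\gamma>0$ the dynamic-memory kernel is $\Psi_\gamma(t;\Theta)=\mathcal L^{-1}\{\Phi(p,\Theta)^{-\gamma}\}(t)$, the function on $(0,\infty)$ whose Laplace transform is $\Phi(p,\Theta)^{-\gamma}$; it is assumed to be integrable on $(0,c)$ for every $c>0$. For $0<\alpha<1$ the (left-sided) Caputo dynamic-memory fractional derivative with lower limit $a$ is $({}^c\mathcal D_{\Phi,a+}^\alpha x)(t)=\int_a^t\Psi_{1-\alpha}(t-s;\Theta)x'(s)\,ds$. Convolution over $[a,t]$ means $(f*g)(t)=\int_a^t f(t-s)g(s)\,ds$. *)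

theory Defs
  imports "HOL-Analysis.Analysis"
begin

definition dynamic_memory_generator :: "(real \<Rightarrow> 'th \<Rightarrow> real) \<Rightarrow> 'th \<Rightarrow> bool" where
  "dynamic_memory_generator \<Phi> \<Theta> \<longleftrightarrow> (\<forall>p>0. \<Phi> p \<Theta> > 0)"

text \<open>The integral over \<open>(0,\<infinity>)\<close> is read as the limit of the Lebesgue integrals over \<open>(0,c)\<close>,
  so conditionally convergent Laplace integrals are admitted as well as absolutely convergent ones.\<close>

definition has_laplace_transform_at :: "(real \<Rightarrow> real) \<Rightarrow> real \<Rightarrow> real \<Rightarrow> bool" where
  "has_laplace_transform_at f F p \<longleftrightarrow>
     (\<forall>c>0. set_integrable lebesgue {0<..<c} (\<lambda>t. exp (- p * t) * f t)) \<and>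
     ((\<lambda>c. LINT t:{0<..<c}|lebesgue. exp (- p * t) * f t) \<longlongrightarrow> F) at_top"

text \<open>The inverse Laplace transform determines the kernel only up to null sets. Hence the kernel
  is given by a predicate that holds for every representative \<open>\<psi>\<close>; the values of \<open>\<psi>\<close>
  outside \<open>(0,\<infinity>)\<close> are unconstrained.\<close>

definition dynamic_memory_kernel ::
  "(real \<Rightarrow> 'th \<Rightarrow> real) \<Rightarrow> 'th \<Rightarrow> real \<Rightarrow> (real \<Rightarrow> real) \<Rightarrow> bool" where
  "dynamic_memory_kernel \<Phi> \<Theta> \<gamma> \<psi> \<longleftrightarrow>
     (\<forall>c>0. set_integrable lebesgue {0<..<c} \<psi>) \<and>
     (\<forall>p>0. has_laplace_transform_at \<psi> (\<Phi> p \<Theta> powr (- \<gamma>)) p)"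

text \<open>\<open>\<Psi> \<gamma> t \<Theta>\<close> stands for \<open>\<Psi>\<^sub>\<gamma>(t;\<Theta>)\<close>. The generator enters only
  through the kernel family \<open>\<Psi>\<close>. The integrand is evaluated at \<open>\<Psi> (1 - \<alpha>) 0 \<Theta>\<close>
  only for \<open>s = t\<close>, a null set.\<close>

definition caputo_dm_deriv ::
  "(real \<Rightarrow> real \<Rightarrow> 'th \<Rightarrow> real) \<Rightarrow> 'th \<Rightarrow> real \<Rightarrow> real \<Rightarrow> (real \<Rightarrow> real) \<Rightarrow> real \<Rightarrow> real" where
  "caputo_dm_deriv \<Psi> \<Theta> \<alpha> a x t =
     (LINT s:{a..t}|lebesgue. \<Psi> (1 - \<alpha>) (t - s) \<Theta> * deriv x s)"

definition convolution_from ::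
  "real \<Rightarrow> (real \<Rightarrow> real) \<Rightarrow> (real \<Rightarrow> real) \<Rightarrow> real \<Rightarrow> real" where
  "convolution_from a f g t = (LINT s:{a..t}|lebesgue. f (t - s) * g s)"

end

theory Submission
  imports Defs
begin

text \<open>A polynomial is smooth, so its Caputo derivative is a single integral of the kernel against
  the ordinary derivative \<open>\<Sum>k=1..n. k c\<^sub>k (s - a)\<^sup>k\<^sup>-\<^sup>1\<close>, and the formula is linearity of the
  integral in that finite sum. All the content is in the integrability that linearity requires.
  The kernel may be unbounded near \<open>0\<close>, but it is integrable on \<open>(0, t - a)\<close> by hypothesis;
  the reflection \<open>s \<mapsto> t - s\<close> carries this to integrability on \<open>[a, t]\<close>
  (\<open>set_integrable_reflect_about\<close>), and a continuous factor, being bounded on a compact interval,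
  preserves it (\<open>set_integrable_mult_continuous\<close>).\<close>

text \<open>The open interval becomes a closed one because endpoints are null; the value of \<open>f\<close>
  at \<open>0\<close> is arbitrary. Lebesgue measure is invariant under the affine map \<open>s \<mapsto> t - s\<close>.\<close>

lemma set_integrable_reflect_about:
  fixes f :: "real \<Rightarrow> real"
  assumes "set_integrable lebesgue {0<..<t - a} f"
  shows "set_integrable lebesgue {a..t} (\<lambda>s. f (t - s))"
proof -
  have "set_integrable lebesgue {0..t - a} f"
    using assms by (simp add: absolutely_integrable_on_Icc_iff_Ioo)
  then have "integrable lebesgue (\<lambda>s. indicator {0..t - a} (t + (-1) * s) *\<^sub>R f (t + (-1) * s))"
    unfolding set_integrable_def by (subst lebesgue_integrable_real_affine_iff) auto
  moreover have "indicator {0..t - a} (t + (-1) * s) = (indicator {a..t} s :: real)" for s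
    by (auto simp: indicator_def)
  ultimately show ?thesis
    by (simp add: set_integrable_def)
qed

lemma set_integrable_mult_continuous:
  fixes f g :: "real \<Rightarrow> real"
  assumes "set_integrable lebesgue {a..b} f" and "continuous_on {a..b} g"
  shows "set_integrable lebesgue {a..b} (\<lambda>s. f s * g s)"
proof -
  have "bounded (g ` {a..b})"
    using assms(2) by (intro compact_imp_bounded compact_continuous_image) auto
  moreover have "g \<in> borel_measurable (lebesgue_on {a..b})"
    using assms(2) by (intro continuous_imp_measurable_on_sets_lebesgue) auto
  ultimately have "set_integrable lebesgue {a..b} (\<lambda>s. g s * f s)"
    using assms(1) by (intro absolutely_integrable_bounded_measurable_product_real) auto
  then show ?thesis
    by (simp add: mult.commute)
qed

lemma deriv_shifted_polynomial:
  fixes c :: "nat \<Rightarrow> real"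
  shows "deriv (\<lambda>u. \<Sum>k=0..n. c k * (u - a) ^ k) s = (\<Sum>k=1..n. real k * c k * (s - a) ^ (k - 1))"
proof -
  have "((\<lambda>u. \<Sum>k=0..n. c k * (u - a) ^ k) has_real_derivative
      (\<Sum>k=0..n. real k * c k * (s - a) ^ (k - 1))) (at s)"
    by (auto intro!: derivative_eq_intros sum.cong simp: algebra_simps)
  then have "deriv (\<lambda>u. \<Sum>k=0..n. c k * (u - a) ^ k) s
      = (\<Sum>k=0..n. real k * c k * (s - a) ^ (k - 1))"
    by (rule DERIV_imp_deriv)
  \<comment> \<open>At \<open>k = 0\<close> the exponent truncates to \<open>0\<close>, but the factor \<open>real k\<close> removes the term.\<close>
  then show ?thesis
    by (simp add: sum.atLeast_Suc_atMost)
qed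

theorem theorem3p40:
  fixes \<Phi> :: "real \<Rightarrow> 'th \<Rightarrow> real" and \<Theta> :: 'th
    and \<Psi> :: "real \<Rightarrow> real \<Rightarrow> 'th \<Rightarrow> real"
    and \<alpha> a t :: real and n :: nat and c :: "nat \<Rightarrow> real" and P :: "real \<Rightarrow> real"
  assumes "dynamic_memory_generator \<Phi> \<Theta>"
    and "0 < \<alpha>" "\<alpha> < 1" "0 \<le> a"
    and "dynamic_memory_kernel \<Phi> \<Theta> (1 - \<alpha>) (\<lambda>u. \<Psi> (1 - \<alpha>) u \<Theta>)"
    and "P = (\<lambda>u. \<Sum>k=0..n. c k * (u - a) ^ k)"
    and "a < t"
  shows "set_integrable lebesgue {a..t} (\<lambda>s. \<Psi> (1 - \<alpha>) (t - s) \<Theta> * deriv P s)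
    \<and> (\<forall>k\<in>{1..n}. set_integrable lebesgue {a..t} (\<lambda>s. \<Psi> (1 - \<alpha>) (t - s) \<Theta> * (s - a) ^ (k - 1)))
    \<and> caputo_dm_deriv \<Psi> \<Theta> \<alpha> a P t
        = (\<Sum>k=1..n. real k * c k * (LINT s:{a..t}|lebesgue. \<Psi> (1 - \<alpha>) (t - s) \<Theta> * (s - a) ^ (k - 1)))
    \<and> caputo_dm_deriv \<Psi> \<Theta> \<alpha> a P t
        = (\<Sum>k=1..n. real k * c k *
             convolution_from a (\<lambda>u. \<Psi> (1 - \<alpha>) u \<Theta>) (\<lambda>s. (s - a) ^ (k - 1)) t)"
proof -
  let ?\<psi> = "\<lambda>s. \<Psi> (1 - \<alpha>) (t - s) \<Theta>"
  have "set_integrable lebesgue {0<..<t - a} (\<lambda>u. \<Psi> (1 - \<alpha>) u \<Theta>)"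
    using assms(5,7) by (simp add: dynamic_memory_kernel_def)
  then have ker: "set_integrable lebesgue {a..t} ?\<psi>"
    by (rule set_integrable_reflect_about)
  have mono: "set_integrable lebesgue {a..t} (\<lambda>s. ?\<psi> s * (s - a) ^ (k - 1))" for k :: nat
    by (intro set_integrable_mult_continuous ker continuous_intros)
  have dP: "deriv P s = (\<Sum>k=1..n. real k * c k * (s - a) ^ (k - 1))" for s
    by (simp only: assms(6) deriv_shifted_polynomial)
  have int: "set_integrable lebesgue {a..t} (\<lambda>s. ?\<psi> s * deriv P s)"
    unfolding dP by (intro set_integrable_mult_continuous ker continuous_intros)
  have expand: "indicator {a..t} s *\<^sub>R (?\<psi> s * deriv P s)
      = (\<Sum>k=1..n. real k * c k * (indicator {a..t} s *\<^sub>R (?\<psi> s * (s - a) ^ (k - 1))))" for s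
    by (simp add: dP sum_distrib_left ac_simps)
  have caputo: "caputo_dm_deriv \<Psi> \<Theta> \<alpha> a P t
      = (\<Sum>k=1..n. real k * c k * (LINT s:{a..t}|lebesgue. ?\<psi> s * (s - a) ^ (k - 1)))"
    using mono unfolding caputo_dm_deriv_def set_lebesgue_integral_def set_integrable_def expand
    by (subst Bochner_Integration.integral_sum) auto
  show ?thesis
    using int mono caputo by (simp add: convolution_from_def)
qed

end
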